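(* Let $G,H\in\mathcal{RH}_\infty^{m\times m}$ with $H$ invertible. The closed-loop system $G(s)\#H(s)$ is stable if, for each $\omega\in[0,\infty)$, $$\overline\sigma(G(j\omega))\,\overline\sigma(H(j\omega))<1.$$ Moreover, at any $\omega\in[0,\infty)$, the displayed inequality at that $\omega$ implies $$DW(G(j\omega))\cap DW\!\left(-\tfrac1\tau H^{-1}(j\omega)\right)=\varnothing\quad\text{for all }\tau\in(0,1].$$
   Context: $\mathcal{RH}_\infty^{m\times m}$ is the set of real, rational, proper, stable $m\times m$ transfer function matrices. $H^{-1}(j\omega)$ denotes the inverse of $H$ evaluated at $j\omega$. For $G,H\in\mathcal{RH}_\infty^{m\times m}$, the standard (negative) feedback interconnection is described by $$G\#H=\begin{bmatrix}(I+HG)^{-1} & (I+HG)^{-1}H\\ G(I+HG)^{-1} & G(I+HG)^{-1}H\end{bmatrix},$$ and the closed-loop system is called stable if $G\#H\in\mathcal{RH}_\infty^{2m\times 2m}$. For $A\in\mathbb{C}^{n\times n}$, $\overline\sigma(A)$ is the largest singular value and the Davis-Wielandt (DW) shell is $DW(A)=\{(x^*Ax,\|Ax\|^2): x\in\mathbb{C}^n,\|x\|=1\}\subset\mathbb{C}\times\mathbb{R}$ (Euclidean norm).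
   Formalization: Stability is proved assuming I+H(∞)G(∞) is nonsingular; without this it fails, e.g. H=1, G=-s/(s+1), where (I+HG)^{-1}=s+1 is not proper. The DW claim is made at those ω where H^{-1}(jω) exists. *)

theory Defs
  imports
    "HOL-Analysis.Analysis"
    "HOL-Computational_Algebra.Computational_Algebra"
    "HOL-Computational_Algebra.Field_as_Ring"
begin

text \<open>Real rational functions form the field \<^typ>\<open>real poly fract\<close>; every one of them is
  represented by its coprime numerator and monic denominator. An \<open>m \<times> m\<close> transfer function
  matrix is a square matrix over this field, with \<open>m = CARD('m) \<ge> 1\<close>.\<close>

type_synonym ratfun = "real poly fract"

definition rf_num :: "ratfun \<Rightarrow> real poly" where
  "rf_num r = fst (quot_of_fract r)"

definition rf_den :: "ratfun \<Rightarrow> real poly" where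
  "rf_den r = snd (quot_of_fract r)"

definition rf_eval :: "ratfun \<Rightarrow> complex \<Rightarrow> complex" where
  "rf_eval r z =
     poly (map_poly of_real (rf_num r)) z / poly (map_poly of_real (rf_den r)) z"

text \<open>As numerator and denominator are coprime, the poles are exactly the roots of the
  denominator. At a pole \<^const>\<open>rf_eval\<close> has the meaningless value 0.\<close>

definition rf_pole :: "ratfun \<Rightarrow> complex \<Rightarrow> bool" where
  "rf_pole r z \<longleftrightarrow> poly (map_poly of_real (rf_den r)) z = 0"

definition rf_proper :: "ratfun \<Rightarrow> bool" where
  "rf_proper r \<longleftrightarrow> degree (rf_num r) \<le> degree (rf_den r)"

definition rf_stable :: "ratfun \<Rightarrow> bool" where
  "rf_stable r \<longleftrightarrow> (\<forall>z. rf_pole r z \<longrightarrow> Re z < 0)"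

text \<open>The limit at infinity of a proper rational function.\<close>

definition rf_at_inf :: "ratfun \<Rightarrow> real" where
  "rf_at_inf r = coeff (rf_num r) (degree (rf_den r)) / lead_coeff (rf_den r)"

definition RH_inf :: "(ratfun ^ 'n ^ 'm) set" where
  "RH_inf = {G. \<forall>i j. rf_proper (G $ i $ j) \<and> rf_stable (G $ i $ j)}"

definition tf_eval :: "ratfun ^ 'n ^ 'm \<Rightarrow> complex \<Rightarrow> complex ^ 'n ^ 'm" where
  "tf_eval G z = (\<chi> i j. rf_eval (G $ i $ j) z)"

definition tf_pole :: "ratfun ^ 'n ^ 'm \<Rightarrow> complex \<Rightarrow> bool" where
  "tf_pole G z \<longleftrightarrow> (\<exists>i j. rf_pole (G $ i $ j) z)"

definition tf_at_inf :: "ratfun ^ 'n ^ 'm \<Rightarrow> real ^ 'n ^ 'm" where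
  "tf_at_inf G = (\<chi> i j. rf_at_inf (G $ i $ j))"

definition block_matrix ::
  "'a ^ 'n1 ^ 'm1 \<Rightarrow> 'a ^ 'n2 ^ 'm1 \<Rightarrow> 'a ^ 'n1 ^ 'm2 \<Rightarrow> 'a ^ 'n2 ^ 'm2
     \<Rightarrow> 'a ^ ('n1 + 'n2) ^ ('m1 + 'm2)" where
  "block_matrix A B C D = (\<chi> i j.
     (case i of
        Inl i' \<Rightarrow> (case j of Inl j' \<Rightarrow> A $ i' $ j' | Inr j' \<Rightarrow> B $ i' $ j')
      | Inr i' \<Rightarrow> (case j of Inl j' \<Rightarrow> C $ i' $ j' | Inr j' \<Rightarrow> D $ i' $ j')))"

definition feedback ::
  "ratfun ^ 'm ^ 'm \<Rightarrow> ratfun ^ 'm ^ 'm \<Rightarrow> ratfun ^ ('m + 'm) ^ ('m + 'm)" where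
  "feedback G H =
     (let S = matrix_inv (mat 1 + H ** G)
      in block_matrix S (S ** H) (G ** S) (G ** S ** H))"

text \<open>\<^const>\<open>matrix_inv\<close> is unspecified on singular matrices, so the existence of the inverse
  in the closed-loop transfer matrix is required explicitly.\<close>

definition closed_loop_stable :: "ratfun ^ 'm ^ 'm \<Rightarrow> ratfun ^ 'm ^ 'm \<Rightarrow> bool" where
  "closed_loop_stable G H \<longleftrightarrow> invertible (mat 1 + H ** G) \<and> feedback G H \<in> RH_inf"

text \<open>Well-posedness of the interconnection of proper systems: \<open>I + H(\<infinity>) G(\<infinity>)\<close> is
  nonsingular. It does not follow from a strict small-gain inequality at all finite frequencies:
  for \<open>G = -s/(s+1)\<close> and \<open>H = 1\<close> the inequality is strict at every finite \<open>\<omega>\<close>, but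
  \<open>(I + H G)\<^sup>-\<^sup>1 = s + 1\<close> is not proper.\<close>

definition well_posed :: "ratfun ^ 'm ^ 'm \<Rightarrow> ratfun ^ 'm ^ 'm \<Rightarrow> bool" where
  "well_posed G H \<longleftrightarrow> invertible (mat 1 + tf_at_inf H ** tf_at_inf G)"

definition conj_transpose :: "complex ^ 'n ^ 'm \<Rightarrow> complex ^ 'm ^ 'n" where
  "conj_transpose A = (\<chi> i j. cnj (A $ j $ i))"

definition singular_values :: "complex ^ 'n ^ 'm \<Rightarrow> real set" where
  "singular_values A =
     {s. s \<ge> 0 \<and> (\<exists>v. v \<noteq> 0 \<and> (conj_transpose A ** A) *v v = complex_of_real (s\<^sup>2) *s v)}"

definition sigma_max :: "complex ^ 'n ^ 'm \<Rightarrow> real" where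
  "sigma_max A = Max (singular_values A)"

definition quad_form :: "complex ^ 'n ^ 'n \<Rightarrow> complex ^ 'n \<Rightarrow> complex" where
  "quad_form A x = (\<Sum>i\<in>UNIV. cnj (x $ i) * (A *v x) $ i)"

definition DW :: "complex ^ 'n ^ 'n \<Rightarrow> (complex \<times> real) set" where
  "DW A = {(quad_form A x, (norm (A *v x))\<^sup>2) | x. norm x = 1}"

end

theory Submission
  imports Defs "HOL-Complex_Analysis.Complex_Analysis"
begin

text \<open>On the imaginary axis \<open>\<parallel>H G v\<parallel> < \<parallel>v\<parallel>\<close>, since the largest singular value bounds the operator
  norm. The maximum principle on the right half-plane, where properness supplies the limit at
  infinity, extends this strict inequality to all \<open>s\<close> with \<open>Re s \<ge> 0\<close>; hence \<open>I + H(s) G(s)\<close> is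
  injective there, and at infinity by well-posedness. So \<open>det (I + H G)\<close> is a unit of the ring of
  proper stable functions, and Cramer's rule puts the closed loop into that ring. No homotopy or
  Nyquist argument is needed. A common point of the two Davis-Wielandt shells would give unit
  vectors \<open>x\<close>, \<open>y\<close> with \<open>\<parallel>H\<^sup>-\<^sup>1 y\<parallel> = \<tau> \<parallel>G x\<parallel>\<close>, so \<open>1 = \<parallel>H H\<^sup>-\<^sup>1 y\<parallel>\<close> would be less than \<open>1\<close>.\<close>

no_notation fps_nth (infixl "$" 75)

section \<open>Evaluation of rational functions\<close>

abbreviation cpoly :: "real poly \<Rightarrow> complex \<Rightarrow> complex" where
  "cpoly p z \<equiv> poly (map_poly of_real p) z"

lemma cpoly_add: "cpoly (p + q) z = cpoly p z + cpoly q z"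
proof -
  have "map_poly complex_of_real (p + q) = map_poly of_real p + map_poly of_real q"
    by (rule poly_eqI) (simp add: coeff_map_poly)
  then show ?thesis by simp
qed

lemma cpoly_mult: "cpoly (p * q) z = cpoly p z * cpoly q z"
proof -
  have "map_poly complex_of_real (p * q) = map_poly of_real p * map_poly of_real q"
    by (rule poly_eqI) (simp add: coeff_map_poly coeff_mult)
  then show ?thesis by simp
qed

lemma cpoly_minus: "cpoly (- p) z = - cpoly p z"
proof -
  have "map_poly complex_of_real (- p) = - map_poly of_real p"
    by (rule poly_eqI) (simp add: coeff_map_poly)
  then show ?thesis by simp
qed

lemma cpoly_cnj: "cpoly p (cnj z) = cnj (cpoly p z)"
proof -
  have "map_poly cnj (map_poly complex_of_real p) = map_poly of_real p"
    by (rule poly_eqI) (simp add: coeff_map_poly)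
  then show ?thesis by (metis poly_cnj)
qed

lemma rf_den_nonzero: "rf_den r \<noteq> 0"
  by (simp add: rf_den_def)

lemma Fract_rf_num_den: "Fract (rf_num r) (rf_den r) = r"
  by (simp add: rf_den_def rf_num_def)

lemma coprime_rf_num_den: "coprime (rf_num r) (rf_den r)"
  using quot_of_fract_in_normalized_fracts[of r]
  by (auto simp: rf_den_def rf_num_def normalized_fracts_def)

text \<open>By coprimality the reduced denominator divides \<open>q\<close>, so it cannot vanish
  where \<open>q\<close> does not. Hence any representation with nonvanishing denominator at
  \<open>z\<close> may be used to evaluate, and the rules for field operations below need no
  reduction to lowest terms.\<close>

lemma rf_eval_Fract:
  assumes "cpoly q z \<noteq> 0"
  shows "\<not> rf_pole (Fract p q) z" and "rf_eval (Fract p q) z = cpoly p z / cpoly q z"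
proof -
  define r where "r = Fract p q"
  have "q \<noteq> 0" using assms by auto
  then have eq: "rf_num r * q = p * rf_den r"
    by (metis Fract_rf_num_den r_def eq_fract(1) rf_den_nonzero)
  then have "rf_den r dvd q"
    by (metis coprime_commute coprime_dvd_mult_right_iff coprime_rf_num_den dvd_triv_right)
  then obtain c where "q = rf_den r * c" by (elim dvdE)
  with assms have den: "cpoly (rf_den r) z \<noteq> 0" by (auto simp: cpoly_mult)
  then show "\<not> rf_pole (Fract p q) z" by (simp add: rf_pole_def r_def)
  have "cpoly (rf_num r) z * cpoly q z = cpoly p z * cpoly (rf_den r) z"
    by (metis cpoly_mult eq)
  then show "rf_eval (Fract p q) z = cpoly p z / cpoly q z"
    using den assms by (simp add: rf_eval_def r_def field_simps)
qed

lemma rf_cases: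
  assumes "\<not> rf_pole r z"
  obtains p q where "r = Fract p q" "cpoly q z \<noteq> 0" "q \<noteq> 0"
  by (metis Fract_rf_num_den assms rf_den_nonzero rf_pole_def)

lemma rf_eval_add:
  assumes "\<not> rf_pole r z" "\<not> rf_pole s z"
  shows "\<not> rf_pole (r + s) z" and "rf_eval (r + s) z = rf_eval r z + rf_eval s z"
proof -
  obtain p q where 1: "r = Fract p q" "cpoly q z \<noteq> 0" "q \<noteq> 0"
    using assms(1) by (rule rf_cases)
  obtain p' q' where 2: "s = Fract p' q'" "cpoly q' z \<noteq> 0" "q' \<noteq> 0"
    using assms(2) by (rule rf_cases)
  have sum: "r + s = Fract (p * q' + p' * q) (q * q')" using 1 2 by simp
  have nz: "cpoly (q * q') z \<noteq> 0" using 1 2 by (simp add: cpoly_mult)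
  show "\<not> rf_pole (r + s) z" unfolding sum by (rule rf_eval_Fract(1)[OF nz])
  show "rf_eval (r + s) z = rf_eval r z + rf_eval s z"
    unfolding sum rf_eval_Fract(2)[OF nz] unfolding 1(1) 2(1)
    by (simp add: rf_eval_Fract(2) 1(2) 2(2) cpoly_mult cpoly_add add_frac_eq)
qed

lemma rf_eval_mult:
  assumes "\<not> rf_pole r z" "\<not> rf_pole s z"
  shows "\<not> rf_pole (r * s) z" and "rf_eval (r * s) z = rf_eval r z * rf_eval s z"
proof -
  obtain p q where 1: "r = Fract p q" "cpoly q z \<noteq> 0" "q \<noteq> 0"
    using assms(1) by (rule rf_cases)
  obtain p' q' where 2: "s = Fract p' q'" "cpoly q' z \<noteq> 0" "q' \<noteq> 0"
    using assms(2) by (rule rf_cases)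
  have prod: "r * s = Fract (p * p') (q * q')" using 1 2 by simp
  have nz: "cpoly (q * q') z \<noteq> 0" using 1 2 by (simp add: cpoly_mult)
  show "\<not> rf_pole (r * s) z" unfolding prod by (rule rf_eval_Fract(1)[OF nz])
  show "rf_eval (r * s) z = rf_eval r z * rf_eval s z"
    unfolding prod rf_eval_Fract(2)[OF nz] unfolding 1(1) 2(1)
    by (simp add: rf_eval_Fract(2) 1(2) 2(2) cpoly_mult)
qed

lemma rf_eval_inverse:
  assumes "\<not> rf_pole r z" "rf_eval r z \<noteq> 0"
  shows "\<not> rf_pole (inverse r) z" and "rf_eval (inverse r) z = inverse (rf_eval r z)"
proof -
  obtain p q where 1: "r = Fract p q" "cpoly q z \<noteq> 0" "q \<noteq> 0"
    using assms(1) by (rule rf_cases)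
  have inv: "inverse r = Fract q p" using 1 by simp
  have nz: "cpoly p z \<noteq> 0" using 1 assms(2) by (simp add: rf_eval_Fract(2))
  show "\<not> rf_pole (inverse r) z" unfolding inv by (rule rf_eval_Fract(1)[OF nz])
  show "rf_eval (inverse r) z = inverse (rf_eval r z)"
    unfolding inv rf_eval_Fract(2)[OF nz] unfolding 1(1) by (simp add: rf_eval_Fract(2) 1(2))
qed

lemma rf_eval_uminus:
  assumes "\<not> rf_pole r z"
  shows "\<not> rf_pole (- r) z" and "rf_eval (- r) z = - rf_eval r z"
proof -
  obtain p q where 1: "r = Fract p q" "cpoly q z \<noteq> 0" "q \<noteq> 0"
    using assms(1) by (rule rf_cases)
  have neg: "- r = Fract (- p) q" using 1 by simp
  show "\<not> rf_pole (- r) z" unfolding neg by (rule rf_eval_Fract(1)[OF 1(2)])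
  show "rf_eval (- r) z = - rf_eval r z"
    unfolding neg unfolding 1(1) by (simp add: rf_eval_Fract(2) 1(2) cpoly_minus)
qed

lemma rf_eval_0: "\<not> rf_pole 0 z" "rf_eval 0 z = 0"
  using rf_eval_Fract[of 1 z 0] by (simp_all add: Zero_fract_def)

lemma rf_eval_1: "\<not> rf_pole 1 z" "rf_eval 1 z = 1"
  using rf_eval_Fract[of 1 z 1] by (simp_all add: One_fract_def)

lemma rf_eval_sum:
  assumes "\<And>i. i \<in> I \<Longrightarrow> \<not> rf_pole (f i) z"
  shows "\<not> rf_pole (\<Sum>i\<in>I. f i) z" and "rf_eval (\<Sum>i\<in>I. f i) z = (\<Sum>i\<in>I. rf_eval (f i) z)"
  using assms
  by (induction I rule: infinite_finite_induct) (simp_all add: rf_eval_0 rf_eval_add)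

lemma rf_eval_prod:
  assumes "\<And>i. i \<in> I \<Longrightarrow> \<not> rf_pole (f i) z"
  shows "\<not> rf_pole (\<Prod>i\<in>I. f i) z" and "rf_eval (\<Prod>i\<in>I. f i) z = (\<Prod>i\<in>I. rf_eval (f i) z)"
  using assms
  by (induction I rule: infinite_finite_induct) (simp_all add: rf_eval_1 rf_eval_mult)

lemma rf_eval_sign:
  "\<not> rf_pole (of_int (sign p)) z" "rf_eval (of_int (sign p)) z = of_int (sign p)"
  by (simp_all add: sign_def rf_eval_1 rf_eval_uminus)

text \<open>This reflects the real coefficients; at a pole both sides are 0. It later transports the
  gain bound from nonnegative to negative frequencies.\<close>

lemma rf_eval_cnj: "rf_eval r (cnj z) = cnj (rf_eval r z)"
  by (simp add: rf_eval_def cpoly_cnj)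

section \<open>Behaviour at infinity: properness as existence of a finite limit\<close>

lemma eventually_not_rf_pole: "\<forall>\<^sub>F z in at_infinity. \<not> rf_pole r z"
proof -
  have "map_poly complex_of_real (rf_den r) \<noteq> 0"
    using rf_den_nonzero by (simp add: map_poly_eq_0_iff)
  then have "finite {z. rf_pole r z}"
    unfolding rf_pole_def by (rule poly_roots_finite)
  then obtain b where b: "\<And>z. rf_pole r z \<Longrightarrow> norm z \<le> b"
    by (metis finite_imp_bounded bounded_iff mem_Collect_eq)
  show ?thesis
    by (rule eventually_at_infinityI[of "b + 1"]) (use b in fastforce)
qed

lemma rf_eval_at_infinity:
  assumes "rf_proper r"
  shows "(rf_eval r \<longlongrightarrow> of_real (rf_at_inf r)) at_infinity"
proof -
  define P where "P = map_poly complex_of_real (rf_num r)"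
  define Q where "Q = map_poly complex_of_real (rf_den r)"
  have deg: "degree P = degree (rf_num r)" "degree Q = degree (rf_den r)"
    by (simp_all add: P_def Q_def degree_map_poly)
  have Q: "Q \<noteq> 0" using rf_den_nonzero by (simp add: Q_def map_poly_eq_0_iff)
  have eval: "rf_eval r = (\<lambda>z. poly P z / poly Q z)"
    by (simp add: rf_eval_def P_def Q_def fun_eq_iff)
  \<comment> \<open>The coefficient is read at the degree of the denominator, so it is 0 for a
    strictly proper function and the leading coefficient when the degrees agree.\<close>
  have inf: "of_real (rf_at_inf r) = coeff P (degree Q) / lead_coeff Q"
    by (simp add: rf_at_inf_def deg) (simp add: P_def Q_def coeff_map_poly)
  show ?thesis
  proof (cases "degree P = degree Q")
    case True
    have "((\<lambda>z. (poly P z / z ^ degree P) / (poly Q z / z ^ degree Q))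
            \<longlongrightarrow> lead_coeff P / lead_coeff Q) at_infinity"
      using Q by (intro tendsto_divide poly_divide_tendsto_aux) auto
    moreover have "\<forall>\<^sub>F z in at_infinity. (poly P z / z ^ degree P) / (poly Q z / z ^ degree Q)
        = poly P z / poly Q z"
      by (rule eventually_at_infinityI[of 1]) (auto simp: True)
    ultimately have "((\<lambda>z. poly P z / poly Q z) \<longlongrightarrow> lead_coeff P / lead_coeff Q) at_infinity"
      by (rule Lim_transform_eventually)
    then show ?thesis
      unfolding eval inf by (simp add: True)
  next
    case False
    then have "degree P < degree Q" using assms by (simp add: deg rf_proper_def)
    then show ?thesis
      unfolding eval inf using poly_divide_tendsto_0_at_infinity by (simp add: coeff_eq_0)
  qed
qed

text \<open>If the numerator had larger degree, \<open>poly Q z / poly P z\<close> would tend to 0,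
  while its product with \<open>rf_eval r z\<close> is eventually 1. Properness thus becomes a
  statement about limits, and its closure under the field operations follows from limit laws instead
  of degree computations.\<close>

lemma rf_properI:
  assumes "(rf_eval r \<longlongrightarrow> L) at_infinity"
  shows "rf_proper r"
proof (rule ccontr)
  define P where "P = map_poly complex_of_real (rf_num r)"
  define Q where "Q = map_poly complex_of_real (rf_den r)"
  assume "\<not> rf_proper r"
  then have lt: "degree Q < degree P"
    by (simp add: P_def Q_def degree_map_poly rf_proper_def)
  then have "((\<lambda>z. rf_eval r z * (poly Q z / poly P z)) \<longlongrightarrow> L * 0) at_infinity"
    by (intro tendsto_mult assms poly_divide_tendsto_0_at_infinity)
  moreover have "\<forall>\<^sub>F z in at_infinity. poly P z \<noteq> 0"
  proof -
    have "filterlim (poly P) at_infinity at_infinity"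
      using lt by (intro filterlim_poly_at_infinity) simp
    then show ?thesis by (rule filterlim_at_infinity_imp_eventually_ne)
  qed
  with eventually_not_rf_pole[of r]
  have "\<forall>\<^sub>F z in at_infinity. rf_eval r z * (poly Q z / poly P z) = 1"
    by eventually_elim (simp add: rf_eval_def rf_pole_def P_def Q_def)
  ultimately have "((\<lambda>z::complex. 1::complex) \<longlongrightarrow> L * 0) at_infinity"
    by (rule Lim_transform_eventually)
  then have "1 = L * 0"
    by (rule tendsto_unique[OF trivial_limit_at_infinity tendsto_const])
  then show False by simp
qed

lemma rf_at_inf_eqI:
  assumes "(rf_eval r \<longlongrightarrow> L) at_infinity"
  shows "of_real (rf_at_inf r) = L"
  using tendsto_unique[OF trivial_limit_at_infinity rf_eval_at_infinity[OF rf_properI[OF assms]] assms] .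

text \<open>Poles are finite in number, so the pointwise evaluation rule holds near infinity and the
  usual limit law applies. Products and inverses are treated in the same way.\<close>

lemma tendsto_rf_eval_add:
  assumes "(rf_eval r \<longlongrightarrow> K) at_infinity" "(rf_eval s \<longlongrightarrow> L) at_infinity"
  shows "(rf_eval (r + s) \<longlongrightarrow> K + L) at_infinity"
proof -
  have "\<forall>\<^sub>F z in at_infinity. rf_eval r z + rf_eval s z = rf_eval (r + s) z"
    using eventually_not_rf_pole[of r] eventually_not_rf_pole[of s]
    by eventually_elim (simp add: rf_eval_add)
  then show ?thesis
    by (rule Lim_transform_eventually[rotated]) (intro tendsto_add assms)
qed

lemma tendsto_rf_eval_mult:
  assumes "(rf_eval r \<longlongrightarrow> K) at_infinity" "(rf_eval s \<longlongrightarrow> L) at_infinity"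
  shows "(rf_eval (r * s) \<longlongrightarrow> K * L) at_infinity"
proof -
  have "\<forall>\<^sub>F z in at_infinity. rf_eval r z * rf_eval s z = rf_eval (r * s) z"
    using eventually_not_rf_pole[of r] eventually_not_rf_pole[of s]
    by eventually_elim (simp add: rf_eval_mult)
  then show ?thesis
    by (rule Lim_transform_eventually[rotated]) (intro tendsto_mult assms)
qed

lemma tendsto_rf_eval_inverse:
  assumes "(rf_eval r \<longlongrightarrow> L) at_infinity" "L \<noteq> 0"
  shows "(rf_eval (inverse r) \<longlongrightarrow> inverse L) at_infinity"
proof -
  have "\<forall>\<^sub>F z in at_infinity. rf_eval r z \<noteq> 0"
    using assms by (rule tendsto_imp_eventually_ne)
  with eventually_not_rf_pole[of r]
  have "\<forall>\<^sub>F z in at_infinity. inverse (rf_eval r z) = rf_eval (inverse r) z"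
    by eventually_elim (simp add: rf_eval_inverse)
  then show ?thesis
    by (rule Lim_transform_eventually[rotated]) (intro tendsto_inverse assms)
qed

lemma tendsto_rf_eval_0: "(rf_eval 0 \<longlongrightarrow> 0) F"
  and tendsto_rf_eval_1: "(rf_eval 1 \<longlongrightarrow> 1) F"
  and tendsto_rf_eval_sign: "(rf_eval (of_int (sign p)) \<longlongrightarrow> of_int (sign p)) F"
proof -
  have "rf_eval 0 = (\<lambda>_. 0)" "rf_eval 1 = (\<lambda>_. 1)"
    "rf_eval (of_int (sign p)) = (\<lambda>_. of_int (sign p))"
    by (auto simp: rf_eval_0 rf_eval_1 rf_eval_sign)
  then show "(rf_eval 0 \<longlongrightarrow> 0) F" "(rf_eval 1 \<longlongrightarrow> 1) F"
    "(rf_eval (of_int (sign p)) \<longlongrightarrow> of_int (sign p)) F"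
    by simp_all
qed

lemma tendsto_rf_eval_sum:
  assumes "\<And>i. i \<in> I \<Longrightarrow> (rf_eval (f i) \<longlongrightarrow> L i) at_infinity"
  shows "(rf_eval (\<Sum>i\<in>I. f i) \<longlongrightarrow> (\<Sum>i\<in>I. L i)) at_infinity"
  using assms
  by (induction I rule: infinite_finite_induct)
     (simp_all add: tendsto_rf_eval_0 tendsto_rf_eval_add)

lemma tendsto_rf_eval_prod:
  assumes "\<And>i. i \<in> I \<Longrightarrow> (rf_eval (f i) \<longlongrightarrow> L i) at_infinity"
  shows "(rf_eval (\<Prod>i\<in>I. f i) \<longlongrightarrow> (\<Prod>i\<in>I. L i)) at_infinity"
  using assms
  by (induction I rule: infinite_finite_induct)
     (simp_all add: tendsto_rf_eval_1 tendsto_rf_eval_mult)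

lemma tendsto_rf_eval_det:
  fixes A :: "ratfun ^ 'n ^ 'n"
  assumes "\<And>i j. (rf_eval (A $ i $ j) \<longlongrightarrow> L $ i $ j) at_infinity"
  shows "(rf_eval (det A) \<longlongrightarrow> det L) at_infinity"
  unfolding det_def
  by (intro tendsto_rf_eval_sum tendsto_rf_eval_mult tendsto_rf_eval_sign tendsto_rf_eval_prod assms)

section \<open>The ring of proper stable rational functions\<close>

definition RH_fun :: "ratfun set" where
  "RH_fun = {r. rf_proper r \<and> rf_stable r}"

lemma RH_fun_not_pole: "r \<in> RH_fun \<Longrightarrow> Re z \<ge> 0 \<Longrightarrow> \<not> rf_pole r z"
  by (force simp: RH_fun_def rf_stable_def)

lemma RH_fun_tendsto: "r \<in> RH_fun \<Longrightarrow> (rf_eval r \<longlongrightarrow> of_real (rf_at_inf r)) at_infinity"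
  by (simp add: RH_fun_def rf_eval_at_infinity)

lemma RH_funI:
  assumes "\<And>z. Re z \<ge> 0 \<Longrightarrow> \<not> rf_pole r z" "(rf_eval r \<longlongrightarrow> L) at_infinity"
  shows "r \<in> RH_fun"
  using assms rf_properI by (force simp: RH_fun_def rf_stable_def not_less[symmetric])

lemma RH_fun_add: "r \<in> RH_fun \<Longrightarrow> s \<in> RH_fun \<Longrightarrow> r + s \<in> RH_fun"
  by (rule RH_funI[OF rf_eval_add(1) tendsto_rf_eval_add])
     (auto simp: RH_fun_not_pole intro: RH_fun_tendsto)

lemma RH_fun_mult: "r \<in> RH_fun \<Longrightarrow> s \<in> RH_fun \<Longrightarrow> r * s \<in> RH_fun"
  by (rule RH_funI[OF rf_eval_mult(1) tendsto_rf_eval_mult])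
     (auto simp: RH_fun_not_pole intro: RH_fun_tendsto)

text \<open>These conditions describe the units of the ring: no zero in the closed right half-plane
  keeps the inverse stable, and a nonzero value at infinity keeps it proper.\<close>

lemma RH_fun_inverse:
  assumes "r \<in> RH_fun" "\<And>z. Re z \<ge> 0 \<Longrightarrow> rf_eval r z \<noteq> 0" "rf_at_inf r \<noteq> 0"
  shows "inverse r \<in> RH_fun"
  by (rule RH_funI[OF rf_eval_inverse(1) tendsto_rf_eval_inverse])
     (use assms in \<open>auto simp: RH_fun_not_pole intro: RH_fun_tendsto\<close>)

lemma RH_fun_0: "0 \<in> RH_fun"
  by (rule RH_funI[OF rf_eval_0(1) tendsto_rf_eval_0])

lemma RH_fun_1: "1 \<in> RH_fun"
  by (rule RH_funI[OF rf_eval_1(1) tendsto_rf_eval_1])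

lemma RH_fun_sign: "of_int (sign p) \<in> RH_fun"
  by (rule RH_funI[OF rf_eval_sign(1) tendsto_rf_eval_sign])

lemma RH_fun_sum: "(\<And>i. i \<in> I \<Longrightarrow> f i \<in> RH_fun) \<Longrightarrow> (\<Sum>i\<in>I. f i) \<in> RH_fun"
  by (induction I rule: infinite_finite_induct) (simp_all add: RH_fun_0 RH_fun_add)

lemma RH_fun_prod: "(\<And>i. i \<in> I \<Longrightarrow> f i \<in> RH_fun) \<Longrightarrow> (\<Prod>i\<in>I. f i) \<in> RH_fun"
  by (induction I rule: infinite_finite_induct) (simp_all add: RH_fun_1 RH_fun_mult)

lemma RH_fun_det: "(\<And>i j. A $ i $ j \<in> RH_fun) \<Longrightarrow> det A \<in> RH_fun"
  for A :: "ratfun ^ 'n ^ 'n"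
  unfolding det_def by (intro RH_fun_sum RH_fun_mult RH_fun_prod RH_fun_sign)

lemma RH_inf_iff: "A \<in> RH_inf \<longleftrightarrow> (\<forall>i j. A $ i $ j \<in> RH_fun)"
  by (simp add: RH_inf_def RH_fun_def)

lemma RH_inf_mult: "A \<in> RH_inf \<Longrightarrow> B \<in> RH_inf \<Longrightarrow> A ** B \<in> RH_inf"
  unfolding RH_inf_iff matrix_matrix_mult_def by (auto intro!: RH_fun_sum RH_fun_mult)

lemma RH_inf_add: "A \<in> RH_inf \<Longrightarrow> B \<in> RH_inf \<Longrightarrow> A + B \<in> RH_inf"
  unfolding RH_inf_iff by (auto intro!: RH_fun_add)

lemma RH_inf_mat_1: "mat 1 \<in> RH_inf"
  unfolding RH_inf_iff mat_def by (auto simp: RH_fun_0 RH_fun_1)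

section \<open>Evaluation of transfer matrices\<close>

lemma tf_eval_add:
  assumes "\<not> tf_pole A z" "\<not> tf_pole B z"
  shows "tf_eval (A + B) z = tf_eval A z + tf_eval B z"
  using assms by (simp add: tf_eval_def tf_pole_def vec_eq_iff rf_eval_add)

lemma tf_eval_mult:
  assumes "\<not> tf_pole A z" "\<not> tf_pole B z"
  shows "tf_eval (A ** B) z = tf_eval A z ** tf_eval B z"
  using assms
  by (simp add: tf_eval_def tf_pole_def vec_eq_iff matrix_matrix_mult_def rf_eval_sum rf_eval_mult)

lemma tf_eval_mat_1: "tf_eval (mat 1) z = mat 1"
  by (simp add: tf_eval_def vec_eq_iff mat_def rf_eval_0 rf_eval_1)

lemma tf_eval_det:
  assumes "\<not> tf_pole A z"
  shows "rf_eval (det A) z = det (tf_eval A z)"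
  using assms
  by (simp add: det_def tf_eval_def tf_pole_def rf_eval_sum rf_eval_mult rf_eval_prod rf_eval_sign)

lemma RH_inf_not_pole: "A \<in> RH_inf \<Longrightarrow> Re z \<ge> 0 \<Longrightarrow> \<not> tf_pole A z"
  by (simp add: RH_inf_iff RH_fun_not_pole tf_pole_def)

lemma tf_eval_cnj: "tf_eval A (cnj z) = (\<chi> i j. cnj (tf_eval A z $ i $ j))"
  by (simp add: tf_eval_def rf_eval_cnj)

section \<open>The largest singular value bounds the operator norm\<close>

text \<open>Complex vectors are treated as a real Euclidean space, whose inner product is the real
  part of the Hermitian one. This is enough for singular values because the eigenvalues of
  \<open>conj_transpose A ** A\<close> in question are real.\<close>

lemma inner_complex_vec: "x \<bullet> y = Re (\<Sum>i\<in>UNIV. cnj (x $ i) * y $ i)" for x y :: "complex ^ 'n"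
  by (simp add: inner_vec_def inner_complex_def)

lemma inner_conj_transpose: "(conj_transpose A *v x) \<bullet> y = x \<bullet> (A *v y)"
proof -
  have "(\<Sum>i\<in>UNIV. cnj ((conj_transpose A *v x) $ i) * y $ i)
      = (\<Sum>i\<in>UNIV. \<Sum>j\<in>UNIV. A $ j $ i * cnj (x $ j) * y $ i)"
    by (simp add: conj_transpose_def matrix_vector_mult_def sum_distrib_right)
  also have "\<dots> = (\<Sum>j\<in>UNIV. \<Sum>i\<in>UNIV. A $ j $ i * cnj (x $ j) * y $ i)"
    by (rule sum.swap)
  also have "\<dots> = (\<Sum>j\<in>UNIV. cnj (x $ j) * (A *v y) $ j)"
    by (simp add: matrix_vector_mult_def sum_distrib_left ac_simps)
  finally show ?thesis by (simp add: inner_complex_vec)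
qed

lemma matrix_vector_mult_scaleR_right: "A *v (c *\<^sub>R x) = c *\<^sub>R (A *v x)"
  for A :: "complex ^ 'n ^ 'm"
  by (simp add: matrix_vector_mult_def vec_eq_iff scaleR_sum_right)

lemma matrix_vector_mult_scaleR_left: "(c *\<^sub>R A) *v x = c *\<^sub>R (A *v x)"
  for A :: "complex ^ 'n ^ 'm"
  by (simp add: matrix_vector_mult_def vec_eq_iff scaleR_sum_right)

lemma linear_matrix_vector_mult_complex: "linear ((*v) (A :: complex ^ 'n ^ 'm))"
  by (rule linearI) (simp_all add: matrix_vector_right_distrib matrix_vector_mult_scaleR_right)

lemma complex_of_real_smult_vec: "complex_of_real c *s x = c *\<^sub>R x" for x :: "complex ^ 'n"
  by (simp add: vec_eq_iff) (simp add: scaleR_conv_of_real)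

lemma norm_add_scaleR_square:
  "(norm (a + t *\<^sub>R b))\<^sup>2 = (norm a)\<^sup>2 + 2 * t * (a \<bullet> b) + t\<^sup>2 * (norm b)\<^sup>2"
  for a b :: "'a :: real_inner"
  unfolding power2_norm_eq_inner
  by (simp add: inner_add_left inner_add_right inner_commute power2_eq_square algebra_simps)

text \<open>Needed to give the \<open>Max\<close> in \<open>sigma_max\<close> its meaning. Choose
  one eigenvector of the self-adjoint matrix \<open>?B\<close> per singular value; those for
  distinct singular values are orthogonal, and a pairwise orthogonal set is finite.\<close>

lemma finite_singular_values: "finite (singular_values A)"
proof -
  let ?B = "conj_transpose A ** A"
  define v where "v s = (SOME v. v \<noteq> 0 \<and> ?B *v v = s\<^sup>2 *\<^sub>R v)" for s :: real
  have v: "v s \<noteq> 0" "?B *v v s = s\<^sup>2 *\<^sub>R v s" "s \<ge> 0" if "s \<in> singular_values A" for s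
  proof -
    from that have "\<exists>v. v \<noteq> 0 \<and> ?B *v v = s\<^sup>2 *\<^sub>R v"
      unfolding singular_values_def complex_of_real_smult_vec by auto
    from someI_ex[OF this] show "v s \<noteq> 0" "?B *v v s = s\<^sup>2 *\<^sub>R v s" by (simp_all add: v_def)
    show "s \<ge> 0" using that by (simp add: singular_values_def)
  qed
  have sym: "(?B *v x) \<bullet> y = x \<bullet> (?B *v y)" for x y
    by (simp add: inner_conj_transpose flip: matrix_vector_mul_assoc)
       (metis inner_commute inner_conj_transpose)
  have orth: "v s \<bullet> v t = 0" if "s \<in> singular_values A" "t \<in> singular_values A" "s \<noteq> t" for s t
  proof -
    have "s\<^sup>2 * (v s \<bullet> v t) = t\<^sup>2 * (v s \<bullet> v t)"
      using sym[of "v s" "v t"] that by (simp add: v)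
    \<comment> \<open>Singular values are nonnegative, so distinct ones have distinct
      squares.\<close>
    moreover have "s\<^sup>2 \<noteq> t\<^sup>2"
      using that v(3) by (simp add: power2_eq_iff_nonneg)
    ultimately show ?thesis by simp
  qed
  have "pairwise orthogonal (v ` singular_values A)"
    using orth by (auto simp: pairwise_def orthogonal_def)
  then have "finite (v ` singular_values A)" by (rule pairwise_orthogonal_imp_finite)
  \<comment> \<open>If two distinct singular values shared their chosen vector, it would be
    orthogonal to itself, hence zero.\<close>
  moreover have "inj_on v (singular_values A)"
    using orth v(1) by (metis inj_onI inner_eq_zero_iff)
  ultimately show ?thesis by (rule finite_imageD)
qed

text \<open>A maximiser \<open>v\<close> of \<open>\<parallel>A v\<parallel>\<close> over the unit sphere is an eigenvector of \<open>A\<^sup>* A\<close>: it minimises the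
  nonnegative form \<open>\<parallel>A v\<parallel>\<^sup>2 \<parallel>w\<parallel>\<^sup>2 - \<parallel>A w\<parallel>\<^sup>2\<close>, whose first variation therefore vanishes at \<open>v\<close>.\<close>

lemma operator_norm_singular_value:
  fixes A :: "complex ^ 'n ^ 'm"
  obtains s where "s \<in> singular_values A" "\<And>w. norm (A *v w) \<le> s * norm w"
proof -
  have "compact (sphere (0 :: complex ^ 'n) 1)" "sphere (0 :: complex ^ 'n) 1 \<noteq> {}"
    by simp_all
  moreover have "continuous_on (sphere 0 1) (\<lambda>x. norm (A *v x))"
    by (intro continuous_on_norm linear_continuous_on
          linear_conv_bounded_linear[THEN iffD1] linear_matrix_vector_mult_complex)
  ultimately obtain v where v: "norm v = 1"
    and max: "\<And>x. norm x = 1 \<Longrightarrow> norm (A *v x) \<le> norm (A *v v)"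
    by (metis continuous_attains_sup mem_sphere_0)
  define s where "s = norm (A *v v)"
  have bound: "norm (A *v w) \<le> s * norm w" for w
  proof (cases "w = 0")
    case False
    have "norm (A *v (w /\<^sub>R norm w)) \<le> s"
      unfolding s_def using False by (intro max) simp
    then show ?thesis
      using False by (simp add: matrix_vector_mult_scaleR_right field_simps)
  qed simp
  \<comment> \<open>The direction of variation is the residual of the eigenvector equation. The
    first-order coefficient \<open>c\<close> is then the squared norm of this residual, so
    \<open>c = 0\<close> is the equation itself.\<close>
  define w where "w = s\<^sup>2 *\<^sub>R v - (conj_transpose A ** A) *v v"
  define c where "c = w \<bullet> w"
  define q where "q = s\<^sup>2 * (norm w)\<^sup>2 - (norm (A *v w))\<^sup>2"
  have c: "c = s\<^sup>2 * (v \<bullet> w) - (A *v v) \<bullet> (A *v w)"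
  proof -
    have "c = s\<^sup>2 * (v \<bullet> w) - ((conj_transpose A ** A) *v v) \<bullet> w"
      unfolding c_def by (subst (1) w_def) (simp add: inner_diff_left)
    then show ?thesis by (simp add: inner_conj_transpose flip: matrix_vector_mul_assoc)
  qed
  have var: "0 \<le> 2 * t * c + t\<^sup>2 * q" for t
  proof -
    have "(norm (A *v (v + t *\<^sub>R w)))\<^sup>2 \<le> (s * norm (v + t *\<^sub>R w))\<^sup>2"
      by (intro power_mono bound) simp
    also have "(s * norm (v + t *\<^sub>R w))\<^sup>2 = s\<^sup>2 * (1 + 2 * t * (v \<bullet> w) + t\<^sup>2 * (norm w)\<^sup>2)"
      by (simp add: power_mult_distrib norm_add_scaleR_square v)
    also have "(norm (A *v (v + t *\<^sub>R w)))\<^sup>2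
        = s\<^sup>2 + 2 * t * ((A *v v) \<bullet> (A *v w)) + t\<^sup>2 * (norm (A *v w))\<^sup>2"
      by (simp add: s_def matrix_vector_right_distrib matrix_vector_mult_scaleR_right
          norm_add_scaleR_square)
    finally show ?thesis by (simp add: c q_def algebra_simps)
  qed
  have "c = 0"
  proof (rule ccontr)
    assume "c \<noteq> 0"
    then have "c > 0" by (simp add: c_def)
    \<comment> \<open>A negative step small enough for the linear term to dominate: the quadratic
      correction satisfies \<open>t * q >= - c\<close>, so \<open>2 * c + t * q\<close> stays
      positive. The summand 1 keeps the denominator nonzero.\<close>
    define t where "t = - c / (1 + \<bar>q\<bar>)"
    have t: "t < 0" "t * q \<ge> - c"
    proof -
      show "t < 0" using \<open>c > 0\<close> by (simp add: t_def divide_neg_pos)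
      have "c * q \<le> c * (1 + \<bar>q\<bar>)" using \<open>c > 0\<close> by (intro mult_left_mono) auto
      then show "t * q \<ge> - c" by (simp add: t_def field_simps)
    qed
    have "2 * t * c + t\<^sup>2 * q = t * (2 * c + t * q)"
      by (simp add: power2_eq_square algebra_simps)
    also have "\<dots> < 0" using t \<open>c > 0\<close> by (intro mult_neg_pos) auto
    finally show False using var[of t] by simp
  qed
  then have "w = 0" by (simp add: c_def)
  then have "(conj_transpose A ** A) *v v = complex_of_real (s\<^sup>2) *s v"
    unfolding complex_of_real_smult_vec by (simp add: w_def)
  moreover have "s \<ge> 0" by (simp add: s_def)
  moreover have "v \<noteq> 0" using v by auto
  ultimately have "s \<in> singular_values A"
    unfolding singular_values_def by blast
  then show thesis using bound that by blast
qed

lemma sigma_max_nonneg: "sigma_max A \<ge> 0"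
  and norm_matrix_vector_le_sigma_max: "norm (A *v w) \<le> sigma_max A * norm w"
proof -
  obtain s where s: "s \<in> singular_values A" "\<And>w. norm (A *v w) \<le> s * norm w"
    using operator_norm_singular_value by blast
  then have le: "s \<le> sigma_max A"
    unfolding sigma_max_def by (intro Max_ge finite_singular_values)
  then show "norm (A *v w) \<le> sigma_max A * norm w"
    using s(2)[of w] by (meson mult_right_mono norm_ge_zero order_trans)
  show "sigma_max A \<ge> 0" using s(1) le by (simp add: singular_values_def)
qed

lemma norm_mult_vec_less:
  assumes "sigma_max A * sigma_max B < 1" "v \<noteq> 0"
  shows "norm (B *v (A *v v)) < norm v"
proof -
  have "norm (B *v (A *v v)) \<le> sigma_max B * norm (A *v v)"
    by (rule norm_matrix_vector_le_sigma_max)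
  also have "\<dots> \<le> sigma_max B * (sigma_max A * norm v)"
    by (intro mult_left_mono norm_matrix_vector_le_sigma_max sigma_max_nonneg)
  also have "\<dots> = (sigma_max A * sigma_max B) * norm v" by (simp add: ac_simps)
  also have "\<dots> < 1 * norm v" using assms by (intro mult_strict_right_mono) auto
  finally show ?thesis by simp
qed

section \<open>Maximum modulus in the right half-plane\<close>

lemma closed_right_half_plane: "closed {z. Re z \<ge> 0}"
  by (simp add: closed_halfspace_Re_ge)

text \<open>The half-plane is unbounded, so the maximum principle is applied to a half-disc around 0
  containing \<open>z\<close>. The diameter is controlled by \<open>axis\<close>, and the arc by the
  limit \<open>L\<close> up to an error \<open>e\<close>.\<close>

lemma max_modulus_half_plane_le:
  assumes holo: "f holomorphic_on {z. Re z > 0}" and cont: "continuous_on {z. Re z \<ge> 0} f"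
    and lim: "(f \<longlongrightarrow> L) at_infinity"
    and axis: "\<And>\<omega>. norm (f (\<i> * of_real \<omega>)) \<le> B"
    and z: "Re z \<ge> 0"
  shows "norm (f z) \<le> B"
proof (rule field_le_epsilon)
  fix e :: real assume "e > 0"
  \<comment> \<open>\<open>L\<close> is also the limit along the imaginary axis, so it inherits the
    bound \<open>B\<close>.\<close>
  have L: "norm L \<le> B"
  proof (rule Lim_norm_ubound)
    show "((\<lambda>\<omega>. f (\<i> * of_real \<omega>)) \<longlongrightarrow> L) at_top"
      by (rule filterlim_compose[OF lim])
         (simp add: filterlim_at_infinity_conv_norm_at_top norm_mult filterlim_abs_real)
  qed (use axis in auto)
  have "\<forall>\<^sub>F w in at_infinity. dist (f w) L < e"
    using lim \<open>e > 0\<close> by (rule tendstoD)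
  then obtain b where b: "\<And>w. norm w \<ge> b \<Longrightarrow> dist (f w) L < e"
    by (auto simp: eventually_at_infinity)
  have big: "norm (f w) \<le> B + e" if "norm w \<ge> b" for w
    using b[OF that] L norm_triangle_ineq2[of "f w" L] by (simp add: dist_norm)
  \<comment> \<open>Radius at least \<open>b\<close> makes the arc bound available; radius at least
    \<open>norm z\<close> puts \<open>z\<close> into the half-disc.\<close>
  define R where "R = max b (norm z)"
  define S where "S = {w. Re w \<ge> 0} \<inter> cball 0 R"
  have clS: "closed S" by (simp add: S_def closed_Int closed_right_half_plane)
  have intS: "interior S = {w. Re w > 0} \<inter> ball 0 R"
    using interior_halfspace_ge[of "1 :: complex" 0] by (simp add: S_def)
  show "norm (f z) \<le> B + e"
  proof (rule maximum_modulus_frontier[of f S])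
    show "f holomorphic_on interior S"
      unfolding intS using holo by (rule holomorphic_on_subset) auto
    show "continuous_on (closure S) f"
      using clS cont by (auto simp: S_def intro: continuous_on_subset)
    show "bounded S" by (simp add: S_def bounded_Int)
    show "z \<in> S" using z by (simp add: S_def R_def)
    show "norm (f w) \<le> B + e" if "w \<in> frontier S" for w
    proof -
      have "w \<in> S" "w \<notin> {w. Re w > 0} \<inter> ball 0 R"
        using that clS intS by (auto simp: frontier_def)
      then consider "Re w = 0" | "norm w \<ge> b"
        by (force simp: S_def R_def)
      then show ?thesis
      proof cases
        case 1
        then have "w = \<i> * of_real (Im w)" by (simp add: complex_eq_iff)
        then show ?thesis using axis[of "Im w"] \<open>e > 0\<close> by simp
      qed (rule big)
    qed
  qed
qed

text \<open>If the bound were attained at \<open>z\<close>, then \<open>z\<close> would lie off the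
  axis, so \<open>f\<close> would be constant on the open half-plane and, by continuity, on its
  closure. This contradicts the strict bound at 0.\<close>

lemma max_modulus_half_plane_less:
  assumes holo: "f holomorphic_on {z. Re z > 0}" and cont: "continuous_on {z. Re z \<ge> 0} f"
    and lim: "(f \<longlongrightarrow> L) at_infinity"
    and axis: "\<And>\<omega>. norm (f (\<i> * of_real \<omega>)) < B"
    and z: "Re z \<ge> 0"
  shows "norm (f z) < B"
proof (rule ccontr)
  assume "\<not> norm (f z) < B"
  moreover have le: "norm (f w) \<le> B" if "Re w \<ge> 0" for w
    using max_modulus_half_plane_le[OF holo cont lim _ that] axis by (simp add: less_imp_le)
  ultimately have eq: "norm (f z) = B" using z by force
  have "Re z \<noteq> 0"
  proof
    assume "Re z = 0"
    then have "z = \<i> * of_real (Im z)" by (simp add: complex_eq_iff)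
    then show False using axis[of "Im z"] eq by simp
  qed
  with z have z': "Re z > 0" by simp
  have "f constant_on {z. Re z > 0}"
  proof (rule maximum_modulus_principle[OF holo])
    show "open {z. Re z > 0}" by (rule open_halfspace_Re_gt)
    show "connected {z. Re z > 0}" by (intro convex_connected convex_halfspace_Re_gt)
    show "open {z. Re z > 0}" by (rule open_halfspace_Re_gt)
    show "z \<in> {z. Re z > 0}" using z' by simp
    show "norm (f w) \<le> norm (f z)" if "w \<in> {z. Re z > 0}" for w
      using that le eq by simp
  qed simp
  moreover have closure: "closure {z. Re z > 0} = {z. Re z \<ge> 0}"
    using closure_halfspace_gt[of "1 :: complex" 0] by simp
  ultimately have "f constant_on {z. Re z \<ge> 0}"
    using constant_on_closureI[of f "{z. Re z > 0}"] cont by simp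
  then have "f z = f 0" using z by (auto simp: constant_on_def)
  then show False using axis[of 0] eq by simp
qed

section \<open>Small gain\<close>

text \<open>Real coefficients allow conjugation to be moved from the frequency to the vector, whose
  norm it preserves.\<close>

lemma norm_mult_vec_cnj:
  "norm (tf_eval H (cnj z) *v (tf_eval G (cnj z) *v v))
     = norm (tf_eval H z *v (tf_eval G z *v (\<chi> i. cnj (v $ i))))"
proof -
  have norm: "norm (\<chi> i. cnj (x $ i)) = norm x" for x :: "complex ^ 'k"
    by (simp add: norm_vec_def)
  have "tf_eval H (cnj z) *v (tf_eval G (cnj z) *v v)
      = (\<chi> i. cnj ((tf_eval H z *v (tf_eval G z *v (\<chi> i. cnj (v $ i)))) $ i))"
    by (simp add: tf_eval_cnj matrix_vector_mult_def vec_eq_iff)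
  then show ?thesis by (simp add: norm)
qed

text \<open>Cauchy-Schwarz for the complex-valued Hermitian form: the maximum principle requires a
  bound on its modulus, beyond one on its real part.\<close>

lemma norm_sum_cnj_mult_le: "norm (\<Sum>i\<in>UNIV. cnj (u $ i) * w $ i) \<le> norm u * norm w"
  for u w :: "complex ^ 'n"
proof -
  have "norm (\<Sum>i\<in>UNIV. cnj (u $ i) * w $ i) \<le> (\<Sum>i\<in>UNIV. \<bar>norm (u $ i)\<bar> * \<bar>norm (w $ i)\<bar>)"
    by (rule sum_norm_le) (simp add: norm_mult)
  also have "\<dots> \<le> norm u * norm w"
    unfolding norm_vec_def by (rule L2_set_mult_ineq)
  finally show ?thesis .
qed

text \<open>Taking the closed half-plane yields both inputs of the maximum principle: holomorphy
  inside and continuity up to the axis.\<close>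

lemma rf_eval_holomorphic:
  assumes "r \<in> RH_fun"
  shows "rf_eval r holomorphic_on {z. Re z \<ge> 0}"
  unfolding rf_eval_def[abs_def]
  by (intro holomorphic_intros) (use RH_fun_not_pole[OF assms] in \<open>simp add: rf_pole_def\<close>)

text \<open>Testing \<open>H(s) G(s) v\<close> against its own value \<open>u\<close> at the point \<open>z\<close> reduces the bound to the
  maximum principle for a scalar function.\<close>

lemma small_gain_half_plane:
  fixes G :: "ratfun ^ 'n ^ 'm" and H :: "ratfun ^ 'm ^ 'k"
  assumes G: "G \<in> RH_inf" and H: "H \<in> RH_inf"
    and gain: "\<And>\<omega>::real. \<omega> \<ge> 0 \<Longrightarrow>
      sigma_max (tf_eval G (\<i> * of_real \<omega>)) * sigma_max (tf_eval H (\<i> * of_real \<omega>)) < 1"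
    and z: "Re z \<ge> 0" and v: "v \<noteq> 0"
  shows "norm (tf_eval H z *v (tf_eval G z *v v)) < norm v"
proof -
  define w where "w s = tf_eval H s *v (tf_eval G s *v v)" for s
  define u where "u = w z"
  define f where "f s = (\<Sum>i\<in>UNIV. cnj (u $ i) * w s $ i)" for s
  have f_eq: "f = (\<lambda>s. \<Sum>i\<in>UNIV. cnj (u $ i) *
      (\<Sum>j\<in>UNIV. rf_eval (H $ i $ j) s * (\<Sum>k\<in>UNIV. rf_eval (G $ j $ k) s * v $ k)))"
    by (simp add: f_def w_def tf_eval_def matrix_vector_mult_def fun_eq_iff)
  have GH: "G $ i $ j \<in> RH_fun" "H $ k $ l \<in> RH_fun" for i j k l
    using G H by (simp_all add: RH_inf_iff)
  have axis: "norm (w (\<i> * of_real \<omega>)) < norm v" for \<omega> :: real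
  proof (cases "\<omega> \<ge> 0")
    case True
    then show ?thesis unfolding w_def using gain v by (intro norm_mult_vec_less)
  next
    \<comment> \<open>The gain is bounded only for nonnegative frequencies; conjugation reduces to
      \<open>- \<omega>\<close> and the conjugated vector.\<close>
    case False
    define v' where "v' = (\<chi> i. cnj (v $ i))"
    have v': "norm v' = norm v" by (simp add: v'_def norm_vec_def)
    have "\<i> * of_real \<omega> = cnj (\<i> * of_real (- \<omega>))" by simp
    then have "norm (w (\<i> * of_real \<omega>))
        = norm (tf_eval H (\<i> * of_real (- \<omega>)) *v (tf_eval G (\<i> * of_real (- \<omega>)) *v v'))"
      unfolding w_def v'_def by (metis norm_mult_vec_cnj)
    also have "\<dots> < norm v'"
      using gain[of "- \<omega>"] False v v' by (intro norm_mult_vec_less) auto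
    finally show ?thesis using v' by simp
  qed
  show ?thesis
  \<comment> \<open>For \<open>u = 0\<close> the strict bound by \<open>norm u * norm v\<close>
    would fail, but the claim is then just positivity of \<open>norm v\<close>.\<close>
  proof (cases "u = 0")
    case True
    then show ?thesis using v by (simp add: u_def w_def)
  next
    case False
    have holo: "f holomorphic_on {s. Re s \<ge> 0}"
      unfolding f_eq by (intro holomorphic_intros rf_eval_holomorphic GH)
    have "norm (f z) < norm u * norm v"
    proof (rule max_modulus_half_plane_less[of f])
      show "f holomorphic_on {s. Re s > 0}"
        using holo by (rule holomorphic_on_subset) auto
      show "continuous_on {s. Re s \<ge> 0} f"
        using holo by (rule holomorphic_on_imp_continuous_on)
      show "(f \<longlongrightarrow> (\<Sum>i\<in>UNIV. cnj (u $ i) * (\<Sum>j\<in>UNIV. of_real (rf_at_inf (H $ i $ j)) *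
          (\<Sum>k\<in>UNIV. of_real (rf_at_inf (G $ j $ k)) * v $ k)))) at_infinity"
        unfolding f_eq by (intro tendsto_intros RH_fun_tendsto GH)
      show "norm (f (\<i> * of_real \<omega>)) < norm u * norm v" for \<omega>
      proof -
        have "norm (f (\<i> * of_real \<omega>)) \<le> norm u * norm (w (\<i> * of_real \<omega>))"
          unfolding f_def by (rule norm_sum_cnj_mult_le)
        also have "\<dots> < norm u * norm v"
          using axis False by simp
        finally show ?thesis .
      qed
    qed (rule z)
    \<comment> \<open>At \<open>z\<close> itself the test gives the squared norm of
      \<open>u\<close>, so one factor \<open>norm u\<close> cancels from the strict
      inequality.\<close>
    moreover have "f z = of_real ((norm u)\<^sup>2)"
      unfolding f_def u_def[symmetric]
      by (simp add: norm_vec_def L2_set_def sum_nonneg complex_norm_square mult.commute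
          del: of_real_power)
    ultimately have "norm u * norm u < norm u * norm v"
      by (simp add: power2_eq_square norm_mult)
    then show ?thesis using False by (simp add: u_def w_def)
  qed
qed

section \<open>Inversion over the ring of proper stable functions, and closed-loop stability\<close>

lemma matrix_inv_right: "invertible A \<Longrightarrow> A ** matrix_inv A = mat 1"
  unfolding matrix_inv_def invertible_def by (metis (mono_tags, lifting) someI_ex)

text \<open>Each column of the inverse solves a linear system with a unit vector on the right.
  Cramer's rule writes its entries as determinants over the ring divided by \<open>det M\<close>,
  which the hypotheses make a unit.\<close>

lemma RH_inf_matrix_inv:
  fixes M :: "ratfun ^ 'm ^ 'm"
  assumes M: "M \<in> RH_inf" and det: "\<And>z. Re z \<ge> 0 \<Longrightarrow> rf_eval (det M) z \<noteq> 0"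
    and det_inf: "rf_at_inf (det M) \<noteq> 0"
  shows "invertible M" and "matrix_inv M \<in> RH_inf"
proof -
  have M': "M $ i $ j \<in> RH_fun" for i j using M by (simp add: RH_inf_iff)
  have nz: "det M \<noteq> 0" using det[of 0] by (auto simp: rf_eval_0)
  then show inv: "invertible M" by (simp add: invertible_det_nz)
  have "inverse (det M) \<in> RH_fun"
    by (intro RH_fun_inverse RH_fun_det M' det det_inf)
  moreover have "det (\<chi> i l. if l = k then mat 1 $ i $ j else M $ i $ l) \<in> RH_fun" for j k
    by (rule RH_fun_det) (simp add: M' mat_def RH_fun_0 RH_fun_1)
  moreover have "matrix_inv M $ k $ j
      = det (\<chi> i l. if l = k then mat 1 $ i $ j else M $ i $ l) * inverse (det M)" for j k
  proof -
    have "M *v (\<chi> k. matrix_inv M $ k $ j) = (\<chi> i. (M ** matrix_inv M) $ i $ j)"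
      by (simp add: matrix_vector_mult_def matrix_matrix_mult_def)
    then have "M *v (\<chi> k. matrix_inv M $ k $ j) = (\<chi> i. mat 1 $ i $ j)"
      by (simp add: matrix_inv_right inv)
    then show ?thesis
      unfolding cramer[OF nz] by (simp add: vec_eq_iff divide_inverse cong: if_cong)
  qed
  ultimately show "matrix_inv M \<in> RH_inf" by (simp add: RH_inf_iff RH_fun_mult)
qed

lemma RH_inf_block_matrix:
  assumes "A \<in> RH_inf" "B \<in> RH_inf" "C \<in> RH_inf" "D \<in> RH_inf"
  shows "block_matrix A B C D \<in> RH_inf"
  using assms by (auto simp: RH_inf_iff block_matrix_def split: sum.split)

lemma small_gain_closed_loop_stable:
  fixes G H :: "ratfun ^ 'm ^ 'm"
  assumes G: "G \<in> RH_inf" and H: "H \<in> RH_inf" and wp: "well_posed G H"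
    and gain: "\<And>\<omega>::real. \<omega> \<ge> 0 \<Longrightarrow>
      sigma_max (tf_eval G (\<i> * of_real \<omega>)) * sigma_max (tf_eval H (\<i> * of_real \<omega>)) < 1"
  shows "closed_loop_stable G H"
proof -
  define M where "M = mat 1 + H ** G"
  have M: "M \<in> RH_inf"
    unfolding M_def by (intro RH_inf_add RH_inf_mult RH_inf_mat_1 G H)
  have det: "rf_eval (det M) z \<noteq> 0" if z: "Re z \<ge> 0" for z
  proof -
    have poles: "\<not> tf_pole G z" "\<not> tf_pole H z" "\<not> tf_pole (mat 1 :: ratfun ^ 'm ^ 'm) z"
      "\<not> tf_pole (H ** G) z" "\<not> tf_pole M z"
      by (intro RH_inf_not_pole z G H M RH_inf_mult RH_inf_mat_1)+
    have eval: "tf_eval M z = mat 1 + tf_eval H z ** tf_eval G z"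
      unfolding M_def by (simp add: tf_eval_add tf_eval_mult tf_eval_mat_1 poles)
    \<comment> \<open>A nonzero kernel vector would satisfy \<open>H G x = - x\<close> at
      \<open>z\<close>, although \<open>H G\<close> strictly shrinks norms there.\<close>
    have "x = 0" if "tf_eval M z *v x = 0" for x
    proof (rule ccontr)
      assume "x \<noteq> 0"
      have "x + tf_eval H z *v (tf_eval G z *v x) = 0"
        using that by (simp add: eval matrix_vector_mult_add_rdistrib matrix_vector_mul_assoc)
      then have "norm (tf_eval H z *v (tf_eval G z *v x)) = norm x"
        by (metis add.inverse_unique norm_minus_cancel)
      with small_gain_half_plane[OF G H gain z \<open>x \<noteq> 0\<close>] show False by simp
    qed
    then have "invertible (tf_eval M z)"
      by (simp add: invertible_left_inverse matrix_left_invertible_ker)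
    then show ?thesis
      using poles by (simp add: tf_eval_det invertible_det_nz)
  qed
  \<comment> \<open>The value of \<open>det M\<close> at infinity is identified with the determinant
    that well-posedness makes nonzero. Limits of evaluations are complex, so the real matrix at
    infinity is embedded entrywise.\<close>
  have "(rf_eval (det M) \<longlongrightarrow>
      det (\<chi> i j. complex_of_real ((mat 1 + tf_at_inf H ** tf_at_inf G) $ i $ j))) at_infinity"
  proof (rule tendsto_rf_eval_det)
    fix i j
    have "(rf_eval ((mat 1 :: ratfun ^ 'm ^ 'm) $ i $ j)
        \<longlongrightarrow> complex_of_real ((mat 1 :: real ^ 'm ^ 'm) $ i $ j)) at_infinity"
      by (simp add: mat_def tendsto_rf_eval_0 tendsto_rf_eval_1)
    moreover have "(rf_eval ((H ** G) $ i $ j)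
        \<longlongrightarrow> complex_of_real ((tf_at_inf H ** tf_at_inf G) $ i $ j)) at_infinity"
      using G H unfolding RH_inf_iff
      by (auto simp: matrix_matrix_mult_def tf_at_inf_def
          intro!: tendsto_rf_eval_sum tendsto_rf_eval_mult RH_fun_tendsto)
    ultimately show "(rf_eval (M $ i $ j)
        \<longlongrightarrow> (\<chi> i j. complex_of_real ((mat 1 + tf_at_inf H ** tf_at_inf G) $ i $ j)) $ i $ j) at_infinity"
      unfolding M_def by (simp add: tendsto_rf_eval_add)
  qed
  moreover have "det (\<chi> i j. complex_of_real (A $ i $ j)) = of_real (det A)" for A :: "real ^ 'm ^ 'm"
    by (simp add: det_def)
  ultimately have "rf_at_inf (det M) = det (mat 1 + tf_at_inf H ** tf_at_inf G)"
    using rf_at_inf_eqI by (metis of_real_eq_iff)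
  then have "rf_at_inf (det M) \<noteq> 0"
    using wp by (simp add: well_posed_def invertible_det_nz)
  note inv = RH_inf_matrix_inv[OF M det this]
  then show ?thesis
    unfolding closed_loop_stable_def feedback_def Let_def M_def[symmetric]
    by (intro conjI RH_inf_block_matrix RH_inf_mult G H)
qed

text \<open>The shells are separated in the real coordinate: \<open>norm (A *v x)\<close> is at most
  \<open>sigma_max A\<close>, while \<open>B ** C = mat 1\<close> forces
  \<open>sigma_max B * norm (C *v y) >= 1\<close> on unit vectors, and dividing by
  \<open>\<tau> <= 1\<close> only enlarges \<open>C\<close>.\<close>

lemma small_gain_DW_disjoint:
  assumes gain: "sigma_max A * sigma_max B < 1" and inv: "B ** C = mat 1" and \<tau>: "\<tau> \<in> {0<..1}"
  shows "DW A \<inter> DW ((- (1 / \<tau>)) *\<^sub>R C) = {}"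
proof (rule ccontr)
  assume "DW A \<inter> DW ((- (1 / \<tau>)) *\<^sub>R C) \<noteq> {}"
  then obtain x y where x: "norm x = 1" and y: "norm y = 1"
    and "(norm (A *v x))\<^sup>2 = (norm (((- (1 / \<tau>)) *\<^sub>R C) *v y))\<^sup>2"
    unfolding DW_def by blast
  then have "norm (A *v x) = norm (((- (1 / \<tau>)) *\<^sub>R C) *v y)" by simp
  then have eq: "norm (C *v y) = \<tau> * norm (A *v x)"
    unfolding matrix_vector_mult_scaleR_left using \<tau> by (simp add: field_simps)
  have "1 = norm (B *v (C *v y))"
    by (simp add: matrix_vector_mul_assoc inv y)
  also have "\<dots> \<le> sigma_max B * (\<tau> * norm (A *v x))"
    using norm_matrix_vector_le_sigma_max[of B "C *v y"] eq by simp
  also have "\<dots> \<le> sigma_max B * (1 * sigma_max A)"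
    using \<tau> norm_matrix_vector_le_sigma_max[of A x] x
    by (intro mult_left_mono mult_mono sigma_max_nonneg) auto
  also have "\<dots> < 1" using gain by (simp add: mult.commute)
  finally show False by simp
qed

theorem lemma4p4:
  fixes G H :: "ratfun ^ 'm ^ 'm"
  assumes "G \<in> RH_inf" and "H \<in> RH_inf" and "invertible H"
  shows "(well_posed G H \<and>
          (\<forall>\<omega>::real. \<omega> \<ge> 0 \<longrightarrow>
             sigma_max (tf_eval G (\<i> * of_real \<omega>)) * sigma_max (tf_eval H (\<i> * of_real \<omega>)) < 1)
            \<longrightarrow> closed_loop_stable G H) \<and>
         (\<forall>\<omega>::real. \<omega> \<ge> 0 \<longrightarrow> \<not> tf_pole (matrix_inv H) (\<i> * of_real \<omega>) \<longrightarrow>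
             sigma_max (tf_eval G (\<i> * of_real \<omega>)) * sigma_max (tf_eval H (\<i> * of_real \<omega>)) < 1
            \<longrightarrow> (\<forall>\<tau>\<in>{0<..1::real}.
                   DW (tf_eval G (\<i> * of_real \<omega>))
                   \<inter> DW ((- (1 / \<tau>)) *\<^sub>R tf_eval (matrix_inv H) (\<i> * of_real \<omega>)) = {}))"
proof (intro conjI impI allI ballI)
  assume "well_posed G H \<and> (\<forall>\<omega>::real. \<omega> \<ge> 0 \<longrightarrow>
    sigma_max (tf_eval G (\<i> * of_real \<omega>)) * sigma_max (tf_eval H (\<i> * of_real \<omega>)) < 1)"
  then show "closed_loop_stable G H"
    using small_gain_closed_loop_stable[OF assms(1,2)] by blast
next
  fix \<omega> \<tau> :: real
  let ?z = "\<i> * complex_of_real \<omega>"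
  assume "\<omega> \<ge> 0" and pole: "\<not> tf_pole (matrix_inv H) ?z" and \<tau>: "\<tau> \<in> {0<..1}"
    and gain: "sigma_max (tf_eval G ?z) * sigma_max (tf_eval H ?z) < 1"
  have "\<not> tf_pole H ?z" using assms(2) by (simp add: RH_inf_not_pole)
  \<comment> \<open>Evaluation respects the product \<open>H ** matrix_inv H\<close> only away from
    poles: stability excludes those of \<open>H\<close> on the axis, and \<open>pole\<close> those
    of the inverse.\<close>
  then have "tf_eval H ?z ** tf_eval (matrix_inv H) ?z = mat 1"
    using pole assms(3) by (simp add: tf_eval_mat_1 matrix_inv_right flip: tf_eval_mult)
  then show "DW (tf_eval G ?z) \<inter> DW ((- (1 / \<tau>)) *\<^sub>R tf_eval (matrix_inv H) ?z) = {}"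
    using gain \<tau> by (intro small_gain_DW_disjoint)
qed

end
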